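(* Let $G$ and $T$ be groups, let $\varphi:G\to T$ be a homomorphism with image $H=\varphi(G)\le T$, and let $V=\varphi(U)$ be the image of a subgroup $U\le G$ of finite index $n=(G:U)$, $1\le n<\infty$. Let $T_{G,U}$ be the Artin transfer from $G$ to $U/U'$. If $\ker(\varphi)\le U$, then the image $(\varphi(\ell_1),\ldots,\varphi(\ell_n))$ of a left transversal $(\ell_1,\ldots,\ell_n)$ of $U$ in $G$ is a left transversal of $V$ in $H$, the index $(H:V)=(G:U)=n$ remains the same and is therefore finite, and the Artin transfer $T_{H,V}$ from $H$ to $V/V'$ exists. Moreover: (1) $\tilde\varphi\circ T_{G,U}=T_{H,V}\circ\varphi$ (where on the right $\varphi$ is regarded as a map $G\to H$), and, consequently, $\varphi(\ker(T_{G,U}))\le\ker(T_{H,V})$. (2) A sufficient condition for the equality $\ker(T_{H,V})=\varphi(\ker(T_{G,U}))$ is $\ker(\varphi)\le U'$. This condition is not necessary: the equality can hold for some $G,U,\varphi$ with $\ker(\varphi)\le U$ but $\ker(\varphi)\not\le U'$.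
   Context: For a group $G$ and a subgroup $U\le G$ of finite index $n$, a left transversal is a system $(\ell_1,\ldots,\ell_n)$ such that $G$ is the disjoint union of the $\ell_iU$. Each $x\in G$ determines a permutation $\lambda_x\in S_n$ with $x\ell_iU=\ell_{\lambda_x(i)}U$. The Artin transfer is the homomorphism $T_{G,U}:G\to U/U'$, $T_{G,U}(x)=\prod_{i=1}^n \ell_{\lambda_x(i)}^{-1}x\ell_i\cdot U'$; it does not depend on the transversal. $U'=[U,U]$. The map $\tilde\varphi:U/U'\to V/V'$, $xU'\mapsto\varphi(x)V'$, is the epimorphism induced by the restriction $\varphi|_U:U\to V$. *)

theory Defs
  imports
    "HOL-Algebra.Left_Coset"
    "HOL-Algebra.Generated_Groups"
    "HOL-Algebra.Solvable_Groups"
    "HOL-Library.Disjoint_Sets"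
begin

text \<open>The quotient $U/U'$. Its elements are right cosets in the library; as $U'$ is normal in $U$,
  these are the left cosets $xU'$ with $x \in U$.\<close>

abbreviation abelianization :: "('a, 'c) monoid_scheme \<Rightarrow> 'a set \<Rightarrow> 'a set monoid" where
  "abelianization G U \<equiv> (G\<lparr>carrier := U\<rparr>) Mod (derived G U)"

definition left_transversal ::
    "('a, 'c) monoid_scheme \<Rightarrow> 'a set \<Rightarrow> nat \<Rightarrow> (nat \<Rightarrow> 'a) \<Rightarrow> bool" where
  "left_transversal G U n l \<longleftrightarrow>
     (\<forall>i\<in>{1..n}. l i \<in> carrier G) \<and>
     disjoint_family_on (\<lambda>i. l i <#\<^bsub>G\<^esub> U) {1..n} \<and>
     (\<Union>i\<in>{1..n}. l i <#\<^bsub>G\<^esub> U) = carrier G"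

text \<open>The permutation $\lambda_x$; only its values on $\{1,\ldots,n\}$ are meaningful.\<close>

definition transversal_perm ::
    "('a, 'c) monoid_scheme \<Rightarrow> 'a set \<Rightarrow> nat \<Rightarrow> (nat \<Rightarrow> 'a) \<Rightarrow> 'a \<Rightarrow> nat \<Rightarrow> nat" where
  "transversal_perm G U n l x i =
     (THE j. j \<in> {1..n} \<and> (x \<otimes>\<^bsub>G\<^esub> l i) <#\<^bsub>G\<^esub> U = l j <#\<^bsub>G\<^esub> U)"

text \<open>The transfer computed from a given transversal. The product is taken in $G$, in the order
  $i = 1, \ldots, n$.\<close>

definition artin_transfer_wrt ::
    "('a, 'c) monoid_scheme \<Rightarrow> 'a set \<Rightarrow> nat \<Rightarrow> (nat \<Rightarrow> 'a) \<Rightarrow> 'a \<Rightarrow> 'a set" where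
  "artin_transfer_wrt G U n l x =
     foldr (\<otimes>\<^bsub>G\<^esub>)
       (map (\<lambda>i. inv\<^bsub>G\<^esub> (l (transversal_perm G U n l x i)) \<otimes>\<^bsub>G\<^esub> x \<otimes>\<^bsub>G\<^esub> l i) [1..<Suc n])
       \<one>\<^bsub>G\<^esub>
     <#\<^bsub>G\<^esub> derived G U"

text \<open>The value does not depend on the transversal, so an arbitrary one is chosen. Meaningful only
  for subgroups of finite index.\<close>

definition artin_transfer :: "('a, 'c) monoid_scheme \<Rightarrow> 'a set \<Rightarrow> 'a \<Rightarrow> 'a set" where
  "artin_transfer G U =
     artin_transfer_wrt G U (card (lcosets\<^bsub>G\<^esub> U))
       (SOME l. left_transversal G U (card (lcosets\<^bsub>G\<^esub> U)) l)"

text \<open>The map $U/U' \to V/V'$, $xU' \mapsto \varphi(x)V'$. The elements of a coset $X$ are exactly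
  its representatives, and all of them give the same value.\<close>

definition induced_map ::
    "('b, 'd) monoid_scheme \<Rightarrow> 'b set \<Rightarrow> ('a \<Rightarrow> 'b) \<Rightarrow> 'a set \<Rightarrow> 'b set" where
  "induced_map H V \<phi> X = the_elem ((\<lambda>x. \<phi> x <#\<^bsub>H\<^esub> derived H V) ` X)"

lemma induced_map_coset:
  assumes "group_hom G H \<phi>" and U: "subgroup U G" and x: "x \<in> U"
  shows "induced_map H (\<phi> ` U) \<phi> (x <#\<^bsub>G\<^esub> derived G U) = \<phi> x <#\<^bsub>H\<^esub> derived H (\<phi> ` U)"
proof -
  interpret group_hom G H \<phi> by fact
  have UG: "U \<subseteq> carrier G" using U by (rule subgroup.subset)
  have D: "subgroup (derived G U) G" using UG by (rule G.derived_is_subgroup)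
  have img: "\<phi> ` derived G U = derived H (\<phi> ` U)" using derived_img[OF UG] by simp
  have DH: "subgroup (derived H (\<phi> ` U)) H"
    using UG by (intro H.derived_is_subgroup) auto
  have xG: "x \<in> carrier G" using x UG by blast
  have *: "\<phi> y <#\<^bsub>H\<^esub> derived H (\<phi> ` U) = \<phi> x <#\<^bsub>H\<^esub> derived H (\<phi> ` U)"
    if y: "y \<in> x <#\<^bsub>G\<^esub> derived G U" for y
  proof -
    obtain d where d: "d \<in> derived G U" "y = x \<otimes>\<^bsub>G\<^esub> d" using y unfolding l_coset_def by blast
    have "d \<in> carrier G" using d D subgroup.subset by blast
    hence "\<phi> y = \<phi> x \<otimes>\<^bsub>H\<^esub> \<phi> d" using d xG by simp
    moreover have "\<phi> d \<in> derived H (\<phi> ` U)" using d img by blast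
    ultimately have "\<phi> y \<in> \<phi> x <#\<^bsub>H\<^esub> derived H (\<phi> ` U)" unfolding l_coset_def by blast
    thus ?thesis using H.l_repr_independence[OF _ _ DH] xG by simp
  qed
  have "x \<in> x <#\<^bsub>G\<^esub> derived G U"
    using xG subgroup.one_closed[OF D] by (force simp: l_coset_def)
  hence "(\<lambda>y. \<phi> y <#\<^bsub>H\<^esub> derived H (\<phi> ` U)) ` (x <#\<^bsub>G\<^esub> derived G U)
       = {\<phi> x <#\<^bsub>H\<^esub> derived H (\<phi> ` U)}"
    using * by blast
  thus ?thesis by (simp add: induced_map_def)
qed

end

theory Submission
  imports Defs "HOL-Algebra.FiniteProduct"
begin

text \<open>
  The transfer is best understood without numbering the cosets. Choose a representative $r(C)$ in
  every left coset $C$ of $U$; for $x \in G$ the element $c_r(x,C) = r(xC)^{-1}\, x\, r(C)$ lies in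
  $U$, and the transfer of $x$ is the product of the classes of all $c_r(x,C)$ in the abelian group
  $U/U'$. Two facts about $c_r$ give everything about a single group. The cocycle identity
  $c_r(xy,C) = c_r(x,yC)\, c_r(y,C)$ makes the transfer a homomorphism, since $C \mapsto yC$ permutes
  the cosets (\<open>coset_transfer_mult\<close>). If $s(C) = r(C)\,u(C)$ is another choice, then
  $u(xC)\, c_s(x,C) = c_r(x,C)\, u(C)$; the factors $u(xC)$ and $u(C)$ have the same product over all
  cosets and cancel (\<open>coset_transfer_independent\<close>). A transversal indexed by $1,\ldots,n$ is such a
  choice, with $\lambda_x$ being translation by $x$ (\<open>artin_transfer_wrt_eq\<close>).

  For the comparison of two groups, $\ker\varphi \le U$ says that every coset of $U$ is a full
  preimage under $\varphi$ (\<open>mem_l_coset_image_iff\<close>). So $aU \mapsto \varphi(a)V$ is a bijection from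
  the cosets of $U$ to those of $V$ that is compatible with translation: transversals go to
  transversals, the permutations $\lambda_x$ and $\lambda_{\varphi(x)}$ agree, and the transfer
  products correspond factor by factor (\<open>induced_map_transfer_wrt\<close>).

  For the kernels, write the transfer of $x$ as $pU'$ with $p \in U$, so that the transfer of
  $\varphi(x)$ is $\varphi(p)V'$. The first is trivial iff $p \in U'$, the second iff
  $\varphi(p) \in V' = \varphi(U')$, that is, iff $p \in U' \ker\varphi$. The two conditions
  coincide when $\ker\varphi \le U'$ (\<open>transfer_kernel_image_eq\<close>). That this is not necessary is
  visible already when the target is trivial (\<open>kernel_condition_not_necessary\<close>).
\<close>

section \<open>Transversals and left cosets\<close>

locale group_subgroup = group G + subgroup U G for G (structure) and U
begin

lemma subgroup_U: "subgroup U G"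
  by (rule subgroup_axioms)

lemma lcosetI: "a \<in> carrier G \<Longrightarrow> a <# U \<in> lcosets U"
  by (auto simp: LCOSETS_def)

lemma lcoset_carrier: "C \<in> lcosets U \<Longrightarrow> a \<in> C \<Longrightarrow> a \<in> carrier G"
  using lcosets_carrier[OF is_group] by blast

lemma lcoset_eq: "C \<in> lcosets U \<Longrightarrow> a \<in> C \<Longrightarrow> a <# U = C"
  using l_repr_independence subgroup_U by (auto simp: LCOSETS_def)

lemma lcoset_translate:
  assumes "x \<in> carrier G" "C \<in> lcosets U"
  shows "x <# C \<in> lcosets U"
  using assms lcos_m_assoc[OF subset] by (fastforce simp: LCOSETS_def)

lemma lcoset_mult:
  assumes "x \<in> carrier G" "y \<in> carrier G" "C \<in> lcosets U"
  shows "(x \<otimes> y) <# C = x <# (y <# C)"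
  using lcos_m_assoc[OF lcosets_carrier[OF is_group]] assms by metis

lemma bij_betw_lcosets:
  assumes x: "x \<in> carrier G"
  shows "bij_betw (\<lambda>C. x <# C) (lcosets U) (lcosets U)"
proof (rule bij_betw_byWitness[where f' = "\<lambda>C. inv x <# C"])
  show "\<forall>C\<in>lcosets U. inv x <# (x <# C) = C" "\<forall>C\<in>lcosets U. x <# (inv x <# C) = C"
    using x lcoset_mult[symmetric] lcos_mult_one lcosets_carrier[OF is_group] by auto
qed (use x lcoset_translate in auto)

lemma bij_betw_transversal:
  assumes "left_transversal G U n l"
  shows "bij_betw (\<lambda>i. l i <# U) {1..n} (lcosets U)"
proof -
  have l: "l i \<in> carrier G" if "i \<in> {1..n}" for i
    using assms that by (auto simp: left_transversal_def)
  have "inj_on (\<lambda>i. l i <# U) {1..n}"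
  proof
    fix i j assume ij: "i \<in> {1..n}" "j \<in> {1..n}" and eq: "l i <# U = l j <# U"
    have "l i \<in> (l i <# U) \<inter> (l j <# U)"
      using lcos_self[OF l subgroup_U] ij eq by blast
    then show "i = j"
      using assms ij unfolding left_transversal_def disjoint_family_on_def by blast
  qed
  moreover have "(\<lambda>i. l i <# U) ` {1..n} = lcosets U"
  proof
    show "(\<lambda>i. l i <# U) ` {1..n} \<subseteq> lcosets U"
      using l lcosetI by auto
    show "lcosets U \<subseteq> (\<lambda>i. l i <# U) ` {1..n}"
    proof
      fix C assume C: "C \<in> lcosets U"
      then obtain a where a: "a \<in> carrier G" "C = a <# U"
        by (auto simp: LCOSETS_def)
      then obtain i where i: "i \<in> {1..n}" "a \<in> l i <# U"
        using assms unfolding left_transversal_def by blast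
      then have "l i <# U = a <# U"
        using l_repr_independence[OF _ l subgroup_U] by blast
      with a i show "C \<in> (\<lambda>i. l i <# U) ` {1..n}" by blast
    qed
  qed
  ultimately show ?thesis by (simp add: bij_betw_def)
qed

lemma ex_left_transversal:
  assumes "finite (lcosets U)"
  shows "\<exists>l. left_transversal G U (card (lcosets U)) l"
proof -
  obtain f where f: "bij_betw f {1..card (lcosets U)} (lcosets U)"
    using ex_bij_betw_nat_finite_1[OF assms] by blast
  have "\<forall>i\<in>{1..card (lcosets U)}. \<exists>a\<in>carrier G. f i = a <# U"
    using bij_betw_apply[OF f] by (auto simp: LCOSETS_def)
  then obtain l where l: "\<And>i. i \<in> {1..card (lcosets U)} \<Longrightarrow> l i \<in> carrier G \<and> f i = l i <# U"
    by metis
  have "disjoint_family_on f {1..card (lcosets U)}"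
    using f lcos_disjoint[OF subgroup_U] bij_betw_apply[OF f]
    unfolding disjoint_family_on_def bij_betw_def inj_on_def by metis
  then have "disjoint_family_on (\<lambda>i. l i <# U) {1..card (lcosets U)}"
    using l by (simp add: disjoint_family_on_def)
  moreover have "(\<Union>i\<in>{1..card (lcosets U)}. l i <# U) = carrier G"
    using l f lcosets_part_G[OF subgroup_U] by (auto simp: bij_betw_def)
  ultimately show ?thesis
    unfolding left_transversal_def using l by blast
qed

text \<open>The coset $x \ell_i U$ contains exactly one representative, so the description that defines
  $\lambda_x(i)$ denotes; on cosets $\lambda_x$ is translation by $x$.\<close>

lemma transversal_perm:
  assumes l: "left_transversal G U n l" and x: "x \<in> carrier G" and i: "i \<in> {1..n}"
  shows "transversal_perm G U n l x i \<in> {1..n}"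
    and "l (transversal_perm G U n l x i) <# U = x <# (l i <# U)"
proof -
  note bij = bij_betw_transversal[OF l]
  have "l i \<in> carrier G" using l i by (auto simp: left_transversal_def)
  then have eq: "(x \<otimes> l i) <# U = x <# (l i <# U)"
    using x lcos_m_assoc[OF subset] by simp
  have "x <# (l i <# U) \<in> lcosets U"
    using bij_betw_apply[OF bij i] lcoset_translate[OF x] by blast
  then obtain j where j: "j \<in> {1..n}" "x <# (l i <# U) = l j <# U"
    using bij_betw_imp_surj_on[OF bij] by blast
  have "\<exists>!j. j \<in> {1..n} \<and> (x \<otimes> l i) <# U = l j <# U"
  proof (rule ex1I)
    show "j \<in> {1..n} \<and> (x \<otimes> l i) <# U = l j <# U" using j eq by simp
    show "k = j" if "k \<in> {1..n} \<and> (x \<otimes> l i) <# U = l k <# U" for k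
      using that j eq bij_betw_imp_inj_on[OF bij] by (auto dest: inj_onD)
  qed
  from theI'[OF this] show "transversal_perm G U n l x i \<in> {1..n}"
    and "l (transversal_perm G U n l x i) <# U = x <# (l i <# U)"
    unfolding transversal_perm_def eq by auto
qed

text \<open>Both $xc$ and $d$ lie in the left coset $xC$, so they differ by an element of $U$ on the right.\<close>

lemma cocycle_in_subgroup:
  assumes "x \<in> carrier G" "C \<in> lcosets U" "c \<in> C" "d \<in> x <# C"
  shows "inv d \<otimes> x \<otimes> c \<in> U"
proof -
  have c: "c \<in> carrier G" using assms lcoset_carrier by blast
  have d: "d \<in> carrier G" using assms lcoset_translate lcoset_carrier by blast
  have "x \<otimes> c \<in> x <# C" using assms by (auto simp: l_coset_def)
  then have "x \<otimes> c \<in> d <# U" using assms lcoset_eq lcoset_translate by blast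
  then show ?thesis
    using lcos_module_imp[OF is_group d] c d assms m_assoc by simp
qed

section \<open>The transfer as a product over cosets\<close>

abbreviation proj :: "'a \<Rightarrow> 'a set" where
  "proj x \<equiv> x <# derived G U"

lemma comm_group_abelianization: "comm_group (abelianization G U)"
  using derived_quot_of_subgroup_is_comm_group[OF subgroup_U] .

sublocale A: comm_group "abelianization G U"
  by (rule comm_group_abelianization)

lemma derived_normal: "derived G U \<lhd> G\<lparr>carrier := U\<rparr>"
  using group.derived_self_is_normal[OF subgroup_imp_group[OF subgroup_U]]
    derived_consistent[OF _ subgroup_U] by simp

text \<open>The quotient group consists of right cosets, the transfer is written with left cosets;
  normality of $U'$ in $U$ reconciles the two.\<close>

lemma proj_eq_rcoset: "x \<in> U \<Longrightarrow> proj x = derived G U #>\<^bsub>G\<lparr>carrier := U\<rparr>\<^esub> x"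
  using normal.coset_eq[OF derived_normal] by (simp add: l_coset_def)

lemma proj_closed: "x \<in> U \<Longrightarrow> proj x \<in> carrier (abelianization G U)"
  using normal.r_coset_hom_Mod[OF derived_normal]
  by (auto simp: proj_eq_rcoset hom_def simp del: carrier_FactGroup)

lemma proj_mult:
  "x \<in> U \<Longrightarrow> y \<in> U \<Longrightarrow> proj (x \<otimes> y) = proj x \<otimes>\<^bsub>abelianization G U\<^esub> proj y"
  using normal.r_coset_hom_Mod[OF derived_normal]
  by (auto simp: proj_eq_rcoset hom_def simp del: mult_FactGroup)

lemma proj_one: "proj \<one> = \<one>\<^bsub>abelianization G U\<^esub>"
  using lcos_mult_one[OF derived_in_carrier[OF subset]] by (simp add: FactGroup_def)

lemma proj_eq_one_iff:
  assumes "x \<in> U"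
  shows "proj x = \<one>\<^bsub>abelianization G U\<^esub> \<longleftrightarrow> x \<in> derived G U"
proof -
  have D: "subgroup (derived G U) G" using derived_is_subgroup[OF subset] .
  have x: "x \<in> carrier G" using assms subset by blast
  have one: "\<one>\<^bsub>abelianization G U\<^esub> = derived G U" by (simp add: FactGroup_def)
  show ?thesis
    unfolding one using lcos_self[OF x D] l_repr_independence[OF _ _ D, of x \<one>]
      lcos_mult_one[OF subgroup.subset[OF D]] by auto
qed

lemma foldr_in_subgroup:
  assumes "\<And>i. i \<in> set xs \<Longrightarrow> f i \<in> U"
  shows "foldr (\<otimes>) (map f xs) \<one> \<in> U"
  using assms by (induction xs) auto

text \<open>Modulo $U'$ the order of the factors is immaterial, so the ordered product in $G$ becomes a
  product over an index set, which can be reindexed.\<close>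

lemma proj_foldr:
  assumes "distinct xs" "\<And>i. i \<in> set xs \<Longrightarrow> f i \<in> U"
  shows "proj (foldr (\<otimes>) (map f xs) \<one>)
      = finprod (abelianization G U) (\<lambda>i. proj (f i)) (set xs)"
  using assms
proof (induction xs)
  case Nil
  then show ?case using proj_one by (simp del: one_FactGroup)
next
  case (Cons a xs)
  have "proj (foldr (\<otimes>) (map f (a # xs)) \<one>)
      = proj (f a) \<otimes>\<^bsub>abelianization G U\<^esub> proj (foldr (\<otimes>) (map f xs) \<one>)"
    using Cons.prems foldr_in_subgroup[of xs f] proj_mult by simp
  also have "\<dots> = proj (f a) \<otimes>\<^bsub>abelianization G U\<^esub>
      finprod (abelianization G U) (\<lambda>i. proj (f i)) (set xs)"
    using Cons by simp
  also have "\<dots> = finprod (abelianization G U) (\<lambda>i. proj (f i)) (set (a # xs))"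
    using Cons.prems proj_closed by (subst list.set(2), subst A.finprod_insert) auto
  finally show ?case .
qed

definition coset_section :: "('a set \<Rightarrow> 'a) \<Rightarrow> bool" where
  "coset_section r \<longleftrightarrow> (\<forall>C\<in>lcosets U. r C \<in> C)"

text \<open>The element $u$ with $x\, r(C) = r(xC)\, u$: the failure of the representatives to be
  permuted by $x$.\<close>

definition cocycle :: "('a set \<Rightarrow> 'a) \<Rightarrow> 'a \<Rightarrow> 'a set \<Rightarrow> 'a" where
  "cocycle r x C = inv (r (x <# C)) \<otimes> x \<otimes> r C"

definition coset_transfer :: "('a set \<Rightarrow> 'a) \<Rightarrow> 'a \<Rightarrow> 'a set" where
  "coset_transfer r x = finprod (abelianization G U) (\<lambda>C. proj (cocycle r x C)) (lcosets U)"

lemma section_carrier: "coset_section r \<Longrightarrow> C \<in> lcosets U \<Longrightarrow> r C \<in> carrier G"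
  using lcoset_carrier by (auto simp: coset_section_def)

lemma cocycle_closed:
  "coset_section r \<Longrightarrow> x \<in> carrier G \<Longrightarrow> C \<in> lcosets U \<Longrightarrow> cocycle r x C \<in> U"
  unfolding cocycle_def coset_section_def
  by (rule cocycle_in_subgroup[of x C]) (auto simp: lcoset_translate)

text \<open>Translation permutes the cosets. This reindexing is the mechanism behind both
  multiplicativity and independence of the representatives.\<close>

lemma finprod_translate:
  assumes "x \<in> carrier G" "\<And>C. C \<in> lcosets U \<Longrightarrow> f C \<in> carrier (abelianization G U)"
  shows "finprod (abelianization G U) (\<lambda>C. f (x <# C)) (lcosets U)
       = finprod (abelianization G U) f (lcosets U)"
  using A.finprod_reindex[of f "\<lambda>C. x <# C" "lcosets U"] bij_betw_lcosets[OF assms(1)] assms(2)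
  by (auto simp: bij_betw_def simp del: carrier_FactGroup)

lemma coset_transfer_closed:
  assumes "coset_section r" "x \<in> carrier G"
  shows "coset_transfer r x \<in> carrier (abelianization G U)"
  unfolding coset_transfer_def
  using assms by (intro A.finprod_closed) (auto intro!: proj_closed cocycle_closed)

text \<open>The product over all cosets of the cocycle identity $c(xy,C) = c(x,yC)\,c(y,C)$.\<close>

lemma coset_transfer_mult:
  assumes r: "coset_section r" and x: "x \<in> carrier G" and y: "y \<in> carrier G"
  shows "coset_transfer r (x \<otimes> y)
       = coset_transfer r x \<otimes>\<^bsub>abelianization G U\<^esub> coset_transfer r y"
proof -
  have cocycle: "cocycle r (x \<otimes> y) C = cocycle r x (y <# C) \<otimes> cocycle r y C"
    if C: "C \<in> lcosets U" for C
  proof -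
    have yC: "y <# C \<in> lcosets U" and xyC: "x <# (y <# C) \<in> lcosets U"
      using lcoset_translate x y C by auto
    note s = section_carrier[OF r C] section_carrier[OF r yC] section_carrier[OF r xyC]
    have "r (y <# C) \<otimes> (inv r (y <# C) \<otimes> (y \<otimes> r C)) = y \<otimes> r C"
      using s y by (simp add: m_assoc[symmetric])
    then show ?thesis
      unfolding cocycle_def lcoset_mult[OF x y C] using s x y by (simp add: m_assoc)
  qed
  have "coset_transfer r (x \<otimes> y) = finprod (abelianization G U)
      (\<lambda>C. proj (cocycle r x (y <# C)) \<otimes>\<^bsub>abelianization G U\<^esub> proj (cocycle r y C)) (lcosets U)"
    unfolding coset_transfer_def
    using r x y by (intro A.finprod_cong')
      (auto simp: cocycle proj_mult cocycle_closed lcoset_translate simp del: mult_FactGroup carrier_FactGroup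
        intro!: A.m_closed proj_closed)
  also have "\<dots> = finprod (abelianization G U) (\<lambda>C. proj (cocycle r x (y <# C))) (lcosets U)
      \<otimes>\<^bsub>abelianization G U\<^esub> coset_transfer r y"
    unfolding coset_transfer_def
    using r x y by (intro A.finprod_multf) (auto intro!: proj_closed cocycle_closed lcoset_translate)
  also have "finprod (abelianization G U) (\<lambda>C. proj (cocycle r x (y <# C))) (lcosets U)
      = coset_transfer r x"
    unfolding coset_transfer_def
    using r x y by (intro finprod_translate) (auto intro!: proj_closed cocycle_closed)
  finally show ?thesis .
qed

text \<open>Changing the representatives by $u$ changes the cocycle by the coboundary of $u$, whose
  product over all cosets is trivial.\<close>

lemma coset_transfer_independent:
  assumes r: "coset_section r" and s: "coset_section s" and x: "x \<in> carrier G"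
  shows "coset_transfer s x = coset_transfer r x"
proof -
  define u where "u C = inv (r C) \<otimes> s C" for C
  have u: "u C \<in> U" if "C \<in> lcosets U" for C
    using cocycle_in_subgroup[OF mem_carrier[OF one_closed] that, of "s C" "r C"] that r s
      lcos_mult_one[OF lcosets_carrier[OF is_group that]] section_carrier[OF r that]
    by (simp add: u_def coset_section_def)
  have eq: "u (x <# C) \<otimes> cocycle s x C = cocycle r x C \<otimes> u C" if C: "C \<in> lcosets U" for C
  proof -
    have xC: "x <# C \<in> lcosets U" using lcoset_translate x C by auto
    note m = section_carrier[OF r C] section_carrier[OF r xC] section_carrier[OF s C] section_carrier[OF s xC]
    have "s (x <# C) \<otimes> (inv s (x <# C) \<otimes> (x \<otimes> s C)) = x \<otimes> s C"
      "r C \<otimes> (inv r C \<otimes> s C) = s C"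
      using m x by (simp_all add: m_assoc[symmetric])
    then show ?thesis
      unfolding cocycle_def u_def using m x by (simp add: m_assoc)
  qed
  (* P is the product of the classes of u(C), equally of u(xC); it appears on both sides of the
     product of the relations eq and is cancelled. *)
  define P where "P = finprod (abelianization G U) (\<lambda>C. proj (u C)) (lcosets U)"
  have P: "P \<in> carrier (abelianization G U)"
    unfolding P_def using u by (intro A.finprod_closed) (auto intro!: proj_closed)
  have "P \<otimes>\<^bsub>abelianization G U\<^esub> coset_transfer s x
      = finprod (abelianization G U) (\<lambda>C. proj (u (x <# C))) (lcosets U)
        \<otimes>\<^bsub>abelianization G U\<^esub> coset_transfer s x"
    unfolding P_def using u x by (subst finprod_translate) (auto intro!: proj_closed)
  also have "\<dots> = finprod (abelianization G U)
      (\<lambda>C. proj (u (x <# C)) \<otimes>\<^bsub>abelianization G U\<^esub> proj (cocycle s x C)) (lcosets U)"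
    unfolding coset_transfer_def using u x s
    by (intro A.finprod_multf[symmetric]) (auto intro!: proj_closed cocycle_closed u lcoset_translate)
  also have "\<dots> = finprod (abelianization G U)
      (\<lambda>C. proj (cocycle r x C) \<otimes>\<^bsub>abelianization G U\<^esub> proj (u C)) (lcosets U)"
    using r s x u by (intro A.finprod_cong')
      (auto simp: proj_mult[symmetric] eq cocycle_closed lcoset_translate
        simp del: mult_FactGroup carrier_FactGroup intro!: A.m_closed proj_closed)
  also have "\<dots> = coset_transfer r x \<otimes>\<^bsub>abelianization G U\<^esub> P"
    unfolding coset_transfer_def P_def using u x r
    by (intro A.finprod_multf) (auto intro!: proj_closed cocycle_closed u)
  also have "\<dots> = P \<otimes>\<^bsub>abelianization G U\<^esub> coset_transfer r x"
    using P coset_transfer_closed[OF r x] by (rule A.m_comm[rotated])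
  finally show ?thesis
    using A.Units_l_cancel[of P "coset_transfer s x" "coset_transfer r x"] P
      coset_transfer_closed[OF s x] coset_transfer_closed[OF r x]
    by (simp only: A.Units_eq)
qed

definition section_of :: "nat \<Rightarrow> (nat \<Rightarrow> 'a) \<Rightarrow> 'a set \<Rightarrow> 'a" where
  "section_of n l C = l (inv_into {1..n} (\<lambda>i. l i <# U) C)"

lemma section_of_transversal:
  assumes l: "left_transversal G U n l"
  shows "coset_section (section_of n l)"
    and "i \<in> {1..n} \<Longrightarrow> section_of n l (l i <# U) = l i"
proof -
  note bij = bij_betw_transversal[OF l]
  show *: "section_of n l (l i <# U) = l i" if "i \<in> {1..n}" for i
    unfolding section_of_def
    using inv_into_f_f[OF bij_betw_imp_inj_on[OF bij] that] by simp
  show "coset_section (section_of n l)"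
    unfolding coset_section_def
  proof
    fix C assume "C \<in> lcosets U"
    then obtain i where i: "i \<in> {1..n}" "C = l i <# U"
      using bij_betw_imp_surj_on[OF bij] by blast
    then have "l i \<in> carrier G" using l by (auto simp: left_transversal_def)
    then show "section_of n l C \<in> C" using i * lcos_self[OF _ subgroup_U] by simp
  qed
qed

lemma transfer_factor_closed:
  assumes l: "left_transversal G U n l" and x: "x \<in> carrier G" and i: "i \<in> {1..n}"
  shows "inv (l (transversal_perm G U n l x i)) \<otimes> x \<otimes> l i \<in> U"
proof (rule cocycle_in_subgroup[OF x])
  have li: "l j \<in> carrier G" if "j \<in> {1..n}" for j
    using l that by (auto simp: left_transversal_def)
  show "l i <# U \<in> lcosets U" "l i \<in> l i <# U"
    using li i lcosetI lcos_self[OF _ subgroup_U] by auto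
  show "l (transversal_perm G U n l x i) \<in> x <# (l i <# U)"
    using transversal_perm[OF l x i] li lcos_self[OF _ subgroup_U] by metis
qed

text \<open>Reindexing along the bijection $i \mapsto \ell_i U$ identifies the transfer of the
  transversal with the transfer of its section.\<close>

lemma artin_transfer_wrt_eq:
  assumes l: "left_transversal G U n l" and x: "x \<in> carrier G"
  shows "artin_transfer_wrt G U n l x = coset_transfer (section_of n l) x"
proof -
  note bij = bij_betw_transversal[OF l] and sec = section_of_transversal[OF l]
  have factor: "inv (l (transversal_perm G U n l x i)) \<otimes> x \<otimes> l i
      = cocycle (section_of n l) x (l i <# U)" if "i \<in> {1..n}" for i
    unfolding cocycle_def
    using sec(2)[OF that] sec(2)[OF transversal_perm(1)[OF l x that]] transversal_perm(2)[OF l x that]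
    by simp
  have set: "set [1..<Suc n] = {1..n}" by auto
  have "artin_transfer_wrt G U n l x = finprod (abelianization G U)
      (\<lambda>i. proj (inv (l (transversal_perm G U n l x i)) \<otimes> x \<otimes> l i)) {1..n}"
    unfolding artin_transfer_wrt_def
    using transfer_factor_closed[OF l x] by (subst proj_foldr) (auto simp only: set distinct_upt)
  also have "\<dots> = finprod (abelianization G U)
      (\<lambda>i. proj (cocycle (section_of n l) x (l i <# U))) {1..n}"
    using factor transfer_factor_closed[OF l x]
    by (intro A.finprod_cong') (auto intro!: proj_closed cocycle_closed sec(1) x bij_betw_apply[OF bij])
  also have "\<dots> = finprod (abelianization G U)
      (\<lambda>C. proj (cocycle (section_of n l) x C)) ((\<lambda>i. l i <# U) ` {1..n})"
    using bij sec(1) x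
    by (intro A.finprod_reindex[symmetric])
       (auto simp: bij_betw_def intro!: proj_closed cocycle_closed bij_betw_apply[OF bij])
  also have "\<dots> = coset_transfer (section_of n l) x"
    using bij by (simp add: coset_transfer_def bij_betw_def)
  finally show ?thesis .
qed

lemma artin_transfer_wrt_independent:
  assumes "left_transversal G U n l" "left_transversal G U m k" "x \<in> carrier G"
  shows "artin_transfer_wrt G U n l x = artin_transfer_wrt G U m k x"
  using assms artin_transfer_wrt_eq coset_transfer_independent section_of_transversal(1) by metis

lemma artin_transfer_eq:
  assumes "left_transversal G U n l" "x \<in> carrier G"
  shows "artin_transfer G U x = artin_transfer_wrt G U n l x"
proof -
  have "finite (lcosets U)"
    using bij_betw_finite[OF bij_betw_transversal[OF assms(1)]] by simp
  from someI_ex[OF ex_left_transversal[OF this]] show ?thesis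
    unfolding artin_transfer_def by (rule artin_transfer_wrt_independent[OF _ assms])
qed

lemma artin_transfer_hom:
  assumes "left_transversal G U n l"
  shows "artin_transfer G U \<in> hom G (abelianization G U)"
proof (rule homI)
  note eq = artin_transfer_eq[OF assms] artin_transfer_wrt_eq[OF assms]
  note sec = section_of_transversal(1)[OF assms]
  show "artin_transfer G U x \<in> carrier (abelianization G U)" if "x \<in> carrier G" for x
    using eq that coset_transfer_closed[OF sec] by metis
  show "artin_transfer G U (x \<otimes> y)
      = artin_transfer G U x \<otimes>\<^bsub>abelianization G U\<^esub> artin_transfer G U y"
    if "x \<in> carrier G" "y \<in> carrier G" for x y
  proof -
    have "x \<otimes> y \<in> carrier G" using that by simp
    then show ?thesis using eq that coset_transfer_mult[OF sec] by metis
  qed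
qed

end

section \<open>Homomorphic images\<close>

text \<open>The codomain is cut down to the image, so \<open>h\<close> is onto: this is $\varphi$ regarded as a map
  $G \to H$.\<close>

locale hom_kernel_in_subgroup = group_hom G H h + group_subgroup G U
  for G (structure) and H (structure) and h and U +
  assumes surj: "h ` carrier G = carrier H"
    and kernel_subset: "kernel G H h \<subseteq> U"
begin

sublocale image: group_subgroup H "h ` U"
  using subgroup_img_is_subgroup[OF subgroup_U] H.is_group by (rule group_subgroup.intro[rotated])

lemma l_coset_image: "a \<in> carrier G \<Longrightarrow> h a <#\<^bsub>H\<^esub> h ` U = h ` (a <# U)"
  using subset by (auto simp: l_coset_def image_iff)

text \<open>This is where $\ker h \le U$ enters: if $h(a) = h(b)\,h(u)$, then $(bu)^{-1}a$ is in the
  kernel, hence in $U$. So distinct cosets of $U$ keep distinct, and even disjoint, images.\<close>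

lemma mem_l_coset_image_iff:
  assumes a: "a \<in> carrier G" and b: "b \<in> carrier G"
  shows "h a \<in> h b <#\<^bsub>H\<^esub> h ` U \<longleftrightarrow> a \<in> b <# U"
proof
  assume "h a \<in> h b <#\<^bsub>H\<^esub> h ` U"
  then obtain u where u: "u \<in> U" "h a = h b \<otimes>\<^bsub>H\<^esub> h u"
    by (auto simp: l_coset_def)
  have uG: "u \<in> carrier G" using u subset by blast
  have "h (inv u \<otimes> (inv b \<otimes> a)) = \<one>\<^bsub>H\<^esub>"
    using a b u uG by (simp add: H.m_assoc[symmetric] H.inv_mult_group[symmetric])
  then have "inv u \<otimes> (inv b \<otimes> a) \<in> U"
    using kernel_subset a b uG by (auto simp: kernel_def)
  then have "u \<otimes> (inv u \<otimes> (inv b \<otimes> a)) \<in> U" using u by simp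
  then have "inv b \<otimes> a \<in> U" using a b uG by (simp add: G.m_assoc[symmetric])
  then show "a \<in> b <# U"
    using a b by (auto simp: l_coset_def G.m_assoc[symmetric] intro!: bexI[of _ "inv b \<otimes> a"])
next
  assume "a \<in> b <# U"
  then show "h a \<in> h b <#\<^bsub>H\<^esub> h ` U" using l_coset_image[OF b] by blast
qed

lemma l_coset_image_eq_iff:
  assumes a: "a \<in> carrier G" and b: "b \<in> carrier G"
  shows "h a <#\<^bsub>H\<^esub> h ` U = h b <#\<^bsub>H\<^esub> h ` U \<longleftrightarrow> a <# U = b <# U"
  using mem_l_coset_image_iff[OF a b] a b G.lcos_self[OF a subgroup_U] l_coset_image
    H.lcos_self[OF hom_closed[OF a] image.subgroup_U]
    G.l_repr_independence[OF _ b subgroup_U] by metis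

lemma left_transversal_image:
  assumes l: "left_transversal G U n l"
  shows "left_transversal H (h ` U) n (h \<circ> l)"
proof -
  have lG: "l i \<in> carrier G" if "i \<in> {1..n}" for i
    using l that by (auto simp: left_transversal_def)
  have "disjoint_family_on (\<lambda>i. (h \<circ> l) i <#\<^bsub>H\<^esub> h ` U) {1..n}"
    unfolding disjoint_family_on_def
  proof (intro ballI impI)
    fix i j assume ij: "i \<in> {1..n}" "j \<in> {1..n}" "i \<noteq> j"
    have "l i <# U \<noteq> l j <# U"
      using bij_betw_imp_inj_on[OF bij_betw_transversal[OF l]] ij by (auto dest: inj_onD)
    then have "h (l i) <#\<^bsub>H\<^esub> h ` U \<noteq> h (l j) <#\<^bsub>H\<^esub> h ` U"
      using l_coset_image_eq_iff lG ij by blast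
    then show "((h \<circ> l) i <#\<^bsub>H\<^esub> h ` U) \<inter> ((h \<circ> l) j <#\<^bsub>H\<^esub> h ` U) = {}"
      using H.lcos_disjoint[OF image.subgroup_U] image.lcosetI lG ij by simp
  qed
  moreover have "(\<Union>i\<in>{1..n}. (h \<circ> l) i <#\<^bsub>H\<^esub> h ` U) = carrier H"
  proof -
    have "(\<Union>i\<in>{1..n}. (h \<circ> l) i <#\<^bsub>H\<^esub> h ` U) = h ` (\<Union>i\<in>{1..n}. l i <# U)"
      using l_coset_image lG by auto
    then show ?thesis
      using l surj by (simp add: left_transversal_def)
  qed
  ultimately show ?thesis
    unfolding left_transversal_def using lG by simp
qed

text \<open>The conditions that define the two permutations are equivalent, because equality of cosets is
  preserved and reflected.\<close>

lemma transversal_perm_image: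
  assumes l: "left_transversal G U n l" and x: "x \<in> carrier G" and i: "i \<in> {1..n}"
  shows "transversal_perm H (h ` U) n (h \<circ> l) (h x) i = transversal_perm G U n l x i"
proof -
  have lG: "l j \<in> carrier G" if "j \<in> {1..n}" for j
    using l that by (auto simp: left_transversal_def)
  have "(h x \<otimes>\<^bsub>H\<^esub> (h \<circ> l) i) <#\<^bsub>H\<^esub> h ` U = (h \<circ> l) j <#\<^bsub>H\<^esub> h ` U
      \<longleftrightarrow> (x \<otimes> l i) <# U = l j <# U" if "j \<in> {1..n}" for j
    using l_coset_image_eq_iff[of "x \<otimes> l i" "l j"] x lG i that by simp
  then show ?thesis
    unfolding transversal_perm_def by (metis (no_types, lifting))
qed

lemma hom_foldr:
  assumes "\<And>i. i \<in> set xs \<Longrightarrow> f i \<in> carrier G"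
  shows "h (foldr (\<otimes>) (map f xs) \<one>) = foldr (\<otimes>\<^bsub>H\<^esub>) (map (\<lambda>i. h (f i)) xs) \<one>\<^bsub>H\<^esub>
    \<and> foldr (\<otimes>) (map f xs) \<one> \<in> carrier G"
  using assms by (induction xs) auto

text \<open>As the permutations agree, $h$ maps each factor of the first product to the corresponding
  factor of the second, in the same order.\<close>

lemma induced_map_transfer_wrt:
  assumes l: "left_transversal G U n l" and x: "x \<in> carrier G"
  shows "induced_map H (h ` U) h (artin_transfer_wrt G U n l x)
       = artin_transfer_wrt H (h ` U) n (h \<circ> l) (h x)"
proof -
  define f where "f i = inv (l (transversal_perm G U n l x i)) \<otimes> x \<otimes> l i" for i
  define p where "p = foldr (\<otimes>) (map f [1..<Suc n]) \<one>"
  have lG: "l i \<in> carrier G" if "i \<in> {1..n}" for i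
    using l that by (auto simp: left_transversal_def)
  have f: "f i \<in> U" if "i \<in> set [1..<Suc n]" for i
    using transfer_factor_closed[OF l x] that by (auto simp: f_def)
  have hf: "h (f i) = inv\<^bsub>H\<^esub> ((h \<circ> l) (transversal_perm H (h ` U) n (h \<circ> l) (h x) i))
      \<otimes>\<^bsub>H\<^esub> h x \<otimes>\<^bsub>H\<^esub> (h \<circ> l) i" if "i \<in> set [1..<Suc n]" for i
  proof -
    have i: "i \<in> {1..n}" using that by auto
    show ?thesis
      unfolding f_def transversal_perm_image[OF l x i]
      using x lG[OF i] lG[OF transversal_perm(1)[OF l x i]] by simp
  qed
  have "h p = foldr (\<otimes>\<^bsub>H\<^esub>) (map (\<lambda>i. h (f i)) [1..<Suc n]) \<one>\<^bsub>H\<^esub>"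
    unfolding p_def using hom_foldr[of "[1..<Suc n]" f] f subset by blast
  also have "map (\<lambda>i. h (f i)) [1..<Suc n]
      = map (\<lambda>i. inv\<^bsub>H\<^esub> ((h \<circ> l) (transversal_perm H (h ` U) n (h \<circ> l) (h x) i))
      \<otimes>\<^bsub>H\<^esub> h x \<otimes>\<^bsub>H\<^esub> (h \<circ> l) i) [1..<Suc n]"
    using hf by (intro map_cong) auto
  finally have "artin_transfer_wrt H (h ` U) n (h \<circ> l) (h x) = h p <#\<^bsub>H\<^esub> derived H (h ` U)"
    by (simp only: artin_transfer_wrt_def)
  moreover have "artin_transfer_wrt G U n l x = proj p"
    by (simp only: artin_transfer_wrt_def p_def f_def[abs_def])
  moreover have "p \<in> U"
    unfolding p_def using f by (rule foldr_in_subgroup)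
  ultimately show ?thesis
    using induced_map_coset[OF group_hom_axioms subgroup_U] by simp
qed

lemma induced_map_transfer:
  assumes l: "left_transversal G U n l" and x: "x \<in> carrier G"
  shows "induced_map H (h ` U) h (artin_transfer G U x) = artin_transfer H (h ` U) (h x)"
  using induced_map_transfer_wrt[OF l x] artin_transfer_eq[OF l x]
    image.artin_transfer_eq[OF left_transversal_image[OF l] hom_closed[OF x]] by simp

text \<open>A common representative $p$ for both transfers reduces the comparison of their kernels to a
  question about $p$.\<close>

lemma transfer_representative:
  assumes l: "left_transversal G U n l" and x: "x \<in> carrier G"
  obtains p where "p \<in> U" "artin_transfer G U x = proj p"
    "artin_transfer H (h ` U) (h x) = image.proj (h p)"
proof -
  have "artin_transfer G U x \<in> carrier (abelianization G U)"
    using artin_transfer_hom[OF l] x by (auto simp: hom_def simp del: carrier_FactGroup)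
  then obtain p where p: "p \<in> U" "artin_transfer G U x = proj p"
    using proj_eq_rcoset by (auto simp: FactGroup_def RCOSETS_def)
  moreover have "artin_transfer H (h ` U) (h x) = image.proj (h p)"
    using induced_map_transfer[OF l x] induced_map_coset[OF group_hom_axioms subgroup_U p(1)]
    by (simp add: p(2))
  ultimately show thesis by (rule that)
qed

lemma mem_transfer_kernel_iff:
  assumes x: "x \<in> carrier G" and p: "p \<in> U" "artin_transfer G U x = proj p"
  shows "x \<in> kernel G (abelianization G U) (artin_transfer G U) \<longleftrightarrow> p \<in> derived G U"
  using x p proj_eq_one_iff by (simp add: kernel_def del: one_FactGroup)

text \<open>$V' = h(U')$, as a homomorphism maps commutators of $U$ onto commutators of $h(U)$.\<close>

lemma mem_image_transfer_kernel_iff: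
  assumes x: "x \<in> carrier G" and p: "p \<in> U" "artin_transfer H (h ` U) (h x) = image.proj (h p)"
  shows "h x \<in> kernel H (abelianization H (h ` U)) (artin_transfer H (h ` U))
      \<longleftrightarrow> h p \<in> h ` derived G U"
  using x p image.proj_eq_one_iff[of "h p"] derived_img[OF subset]
  by (simp add: kernel_def del: one_FactGroup)

lemma transfer_kernel_image_subset:
  assumes l: "left_transversal G U n l"
  shows "h ` kernel G (abelianization G U) (artin_transfer G U)
    \<subseteq> kernel H (abelianization H (h ` U)) (artin_transfer H (h ` U))"
proof
  fix y assume "y \<in> h ` kernel G (abelianization G U) (artin_transfer G U)"
  then obtain x where x: "x \<in> kernel G (abelianization G U) (artin_transfer G U)" "y = h x"
    by blast
  then have xG: "x \<in> carrier G" by (simp add: kernel_def)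
  obtain p where p: "p \<in> U" "artin_transfer G U x = proj p"
    "artin_transfer H (h ` U) (h x) = image.proj (h p)"
    using transfer_representative[OF l xG] .
  then show "y \<in> kernel H (abelianization H (h ` U)) (artin_transfer H (h ` U))"
    using x mem_transfer_kernel_iff[OF xG p(1,2)] mem_image_transfer_kernel_iff[OF xG p(1,3)] by blast
qed

text \<open>From $h(p) \in h(U')$ it follows that $p$ is a product of an element of $U'$ and one of the
  kernel; under the hypothesis the latter is in $U'$ as well.\<close>

lemma transfer_kernel_image_eq:
  assumes l: "left_transversal G U n l" and ker: "kernel G H h \<subseteq> derived G U"
  shows "kernel H (abelianization H (h ` U)) (artin_transfer H (h ` U))
    = h ` kernel G (abelianization G U) (artin_transfer G U)"
proof
  show "h ` kernel G (abelianization G U) (artin_transfer G U)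
    \<subseteq> kernel H (abelianization H (h ` U)) (artin_transfer H (h ` U))"
    using transfer_kernel_image_subset[OF l] .
  show "kernel H (abelianization H (h ` U)) (artin_transfer H (h ` U))
    \<subseteq> h ` kernel G (abelianization G U) (artin_transfer G U)"
  proof
    fix y assume y: "y \<in> kernel H (abelianization H (h ` U)) (artin_transfer H (h ` U))"
    then have "y \<in> h ` carrier G" by (simp add: surj kernel_def)
    then obtain x where x: "x \<in> carrier G" "y = h x" by blast
    obtain p where p: "p \<in> U" "artin_transfer G U x = proj p"
      "artin_transfer H (h ` U) (h x) = image.proj (h p)"
      using transfer_representative[OF l x(1)] .
    then obtain d where d: "d \<in> derived G U" "h p = h d"
      using y x mem_image_transfer_kernel_iff[OF x(1) p(1,3)] by auto
    have D: "subgroup (derived G U) G" using G.derived_is_subgroup[OF subset] .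
    have dG: "d \<in> carrier G" using d D subgroup.subset by blast
    have pG: "p \<in> carrier G" using p subset by blast
    have "inv d \<otimes> p \<in> kernel G H h" using d dG pG by (simp add: kernel_def)
    then have "d \<otimes> (inv d \<otimes> p) \<in> derived G U"
      using subgroup.m_closed[OF D d(1)] ker by blast
    then have "p \<in> derived G U" using dG pG by (simp add: G.m_assoc[symmetric])
    then show "y \<in> h ` kernel G (abelianization G U) (artin_transfer G U)"
      using x mem_transfer_kernel_iff[OF x(1) p(1,2)] by blast
  qed
qed

end

lemma hom_kernel_in_subgroup_onto_image:
  assumes "group G" "group T" "h \<in> hom G T" "subgroup U G" "kernel G T h \<subseteq> U"
  shows "hom_kernel_in_subgroup G (T\<lparr>carrier := h ` carrier G\<rparr>) h U"
proof -
  interpret group_hom G T h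
    using assms by (simp add: group_hom_def group_hom_axioms_def)
  have "group (T\<lparr>carrier := h ` carrier G\<rparr>)"
    using H.subgroup_imp_group[OF img_is_subgroup] .
  moreover have "h \<in> hom G (T\<lparr>carrier := h ` carrier G\<rparr>)"
    using assms by (auto simp: hom_def)
  ultimately show ?thesis
    using assms by (simp add: hom_kernel_in_subgroup_def hom_kernel_in_subgroup_axioms_def
        group_hom_def group_hom_axioms_def group_subgroup_def kernel_def)
qed

section \<open>Equality of the kernels without the sufficient condition\<close>

definition C2 :: "nat monoid" where
  "C2 = \<lparr>carrier = {0, 1}, mult = (\<lambda>x y. (x + y) mod 2), one = 0\<rparr>"

definition C1 :: "nat monoid" where
  "C1 = \<lparr>carrier = {0}, mult = (\<lambda>x y. 0), one = 0\<rparr>"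

lemma comm_group_C2: "comm_group C2"
  by (rule comm_groupI) (auto simp: C2_def)

lemma comm_group_C1: "comm_group C1"
  by (rule comm_groupI) (auto simp: C1_def)

text \<open>Let $\varphi$ be the map from the group of order two onto the trivial group and let $U$ be
  the whole group. Then $\ker\varphi = U$ is not contained in $U' = 1$. The inclusion of
  $\varphi(\ker T_{G,U})$ in $\ker T_{H,V}$ is one of a nonempty set in a subset of a singleton,
  hence an equality.\<close>

lemma kernel_condition_not_necessary:
  "\<exists>(G0 :: nat monoid) (T0 :: nat monoid) H0 \<phi>0 U0 V0.
          group G0 \<and> group T0 \<and> \<phi>0 \<in> hom G0 T0
          \<and> H0 = T0\<lparr>carrier := \<phi>0 ` carrier G0\<rparr>
          \<and> subgroup U0 G0 \<and> V0 = \<phi>0 ` U0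
          \<and> finite (lcosets\<^bsub>G0\<^esub> U0)
          \<and> kernel G0 T0 \<phi>0 \<subseteq> U0
          \<and> \<not> kernel G0 T0 \<phi>0 \<subseteq> derived G0 U0
          \<and> kernel H0 (abelianization H0 V0) (artin_transfer H0 V0)
              = \<phi>0 ` kernel G0 (abelianization G0 U0) (artin_transfer G0 U0)"
proof -
  define h where "h = (\<lambda>_ :: nat. 0 :: nat)"
  define H0 where "H0 = C1\<lparr>carrier := h ` carrier C2\<rparr>"
  interpret C2: comm_group C2 by (rule comm_group_C2)
  interpret C1: comm_group C1 by (rule comm_group_C1)
  have h: "h \<in> hom C2 C1" by (auto simp: hom_def C1_def h_def)
  have U: "subgroup (carrier C2) C2" by (rule C2.subgroup_self)
  have ker: "kernel C2 C1 h = carrier C2" by (auto simp: kernel_def h_def C1_def)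
  have fin: "finite (lcosets\<^bsub>C2\<^esub> carrier C2)" by (auto simp: LCOSETS_def C2_def)
  interpret hom_kernel_in_subgroup C2 H0 h "carrier C2"
    unfolding H0_def using ker
    by (intro hom_kernel_in_subgroup_onto_image C2.is_group C1.is_group h U) auto
  obtain l where l: "left_transversal C2 (carrier C2) (card (lcosets\<^bsub>C2\<^esub> carrier C2)) l"
    using ex_left_transversal[OF fin] by blast
  have "\<one>\<^bsub>C2\<^esub> \<in> kernel C2 (abelianization C2 (carrier C2)) (artin_transfer C2 (carrier C2))"
    using Group.hom_one[OF artin_transfer_hom[OF l] C2.is_group A.is_group] by (simp add: kernel_def)
  moreover have "kernel H0 (abelianization H0 (h ` carrier C2)) (artin_transfer H0 (h ` carrier C2)) \<subseteq> {0}"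
    by (auto simp: kernel_def H0_def h_def)
  ultimately have "kernel H0 (abelianization H0 (h ` carrier C2)) (artin_transfer H0 (h ` carrier C2))
      = h ` kernel C2 (abelianization C2 (carrier C2)) (artin_transfer C2 (carrier C2))"
    using transfer_kernel_image_subset[OF l] by (auto simp: h_def)
  moreover have "\<not> kernel C2 C1 h \<subseteq> derived C2 (carrier C2)"
    unfolding ker C2.derived_eq_singleton[OF subset_refl] by (auto simp: C2_def)
  ultimately show ?thesis
    using C2.is_group C1.is_group h U fin ker H0_def
    by (intro exI[of _ C2] exI[of _ C1] exI[of _ H0] exI[of _ h]
        exI[of _ "carrier C2"] exI[of _ "h ` carrier C2"]) simp
qed

section \<open>The transfer of a homomorphic image\<close>

theorem theorem5p2:
  fixes G :: "('a, 'c) monoid_scheme" and T H :: "('b, 'd) monoid_scheme"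
    and \<phi> :: "'a \<Rightarrow> 'b" and U :: "'a set" and V :: "'b set" and n :: nat
  assumes "group G" and "group T"
    and "\<phi> \<in> hom G T"
    and "H = T\<lparr>carrier := \<phi> ` carrier G\<rparr>"
    and "subgroup U G"
    and "V = \<phi> ` U"
    and "finite (lcosets\<^bsub>G\<^esub> U)" and "n = card (lcosets\<^bsub>G\<^esub> U)" and "1 \<le> n"
    and "kernel G T \<phi> \<subseteq> U"
  shows
    "(\<forall>l. left_transversal G U n l \<longrightarrow> left_transversal H V n (\<phi> \<circ> l))
     \<and> finite (lcosets\<^bsub>H\<^esub> V) \<and> card (lcosets\<^bsub>H\<^esub> V) = n
     \<and> (\<comment> \<open>the transfer from H exists: it can be computed from some transversal, does not depend
            on the choice, and is a homomorphism\<close>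
        (\<exists>m. left_transversal H V n m)
        \<and> (\<forall>m. left_transversal H V n m \<longrightarrow>
               (\<forall>y\<in>carrier H. artin_transfer_wrt H V n m y = artin_transfer H V y))
        \<and> artin_transfer H V \<in> hom H (abelianization H V))
     \<and> (\<forall>x\<in>carrier G.
          induced_map H V \<phi> (artin_transfer G U x) = artin_transfer H V (\<phi> x))
     \<and> \<phi> ` kernel G (abelianization G U) (artin_transfer G U)
          \<subseteq> kernel H (abelianization H V) (artin_transfer H V)
     \<and> (kernel G T \<phi> \<subseteq> derived G U \<longrightarrow>
          kernel H (abelianization H V) (artin_transfer H V)
            = \<phi> ` kernel G (abelianization G U) (artin_transfer G U))
     \<and> (\<exists>(G0 :: nat monoid) (T0 :: nat monoid) H0 \<phi>0 U0 V0.
          group G0 \<and> group T0 \<and> \<phi>0 \<in> hom G0 T0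
          \<and> H0 = T0\<lparr>carrier := \<phi>0 ` carrier G0\<rparr>
          \<and> subgroup U0 G0 \<and> V0 = \<phi>0 ` U0
          \<and> finite (lcosets\<^bsub>G0\<^esub> U0)
          \<and> kernel G0 T0 \<phi>0 \<subseteq> U0
          \<and> \<not> kernel G0 T0 \<phi>0 \<subseteq> derived G0 U0
          \<and> kernel H0 (abelianization H0 V0) (artin_transfer H0 V0)
              = \<phi>0 ` kernel G0 (abelianization G0 U0) (artin_transfer G0 U0))"
proof -
  have H: "H = T\<lparr>carrier := \<phi> ` carrier G\<rparr>" and V: "V = \<phi> ` U" by fact+
  interpret hom_kernel_in_subgroup G H \<phi> U
    unfolding H by (rule hom_kernel_in_subgroup_onto_image) fact+
  have ker: "kernel G H \<phi> = kernel G T \<phi>" by (simp add: kernel_def H)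
  obtain l where l: "left_transversal G U n l"
    using ex_left_transversal assms(7,8) by blast
  note m = left_transversal_image[OF l, folded V]
  have bij: "bij_betw (\<lambda>i. (\<phi> \<circ> l) i <#\<^bsub>H\<^esub> V) {1..n} (lcosets\<^bsub>H\<^esub> V)"
    using image.bij_betw_transversal m unfolding V by blast
  have "finite (lcosets\<^bsub>H\<^esub> V)" "card (lcosets\<^bsub>H\<^esub> V) = n"
    using bij_betw_finite[OF bij] bij_betw_same_card[OF bij] by auto
  moreover have "\<forall>l. left_transversal G U n l \<longrightarrow> left_transversal H V n (\<phi> \<circ> l)"
    using left_transversal_image unfolding V by blast
  moreover have "\<forall>k. left_transversal H V n k \<longrightarrow>
      (\<forall>y\<in>carrier H. artin_transfer_wrt H V n k y = artin_transfer H V y)"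
    using image.artin_transfer_eq unfolding V by metis
  moreover have "artin_transfer H V \<in> hom H (abelianization H V)"
    using image.artin_transfer_hom m unfolding V by blast
  moreover have "\<forall>x\<in>carrier G.
      induced_map H V \<phi> (artin_transfer G U x) = artin_transfer H V (\<phi> x)"
    using induced_map_transfer[OF l] unfolding V by blast
  moreover note transfer_kernel_image_subset[OF l, folded V]
    transfer_kernel_image_eq[OF l, folded V, unfolded ker]
  ultimately show ?thesis
    using m kernel_condition_not_necessary by (intro conjI impI) (assumption | rule exI)+
qed

end
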